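(* Let $n\ge 1$, let $l>1$ be an odd integer and $\varepsilon\in\mathbf C$ a primitive $l$-th root of unity. Let $r,s\in(\mathbf C^\times)^n$ and $a,b\in(\mathbf C^\times)^{n(n+1)/2}$ satisfy $$a_{i,k}a_{i,k+1}\cdots a_{i,n}=1,\qquad r_i\,b_{i,k}b_{i,k-1}b_{i-1,k-1}^{-1}b_{i+1,k}^{-1}=1\qquad(1\le i\le k\le n).$$ Then, in the $U_\varepsilon$-module $(\Phi_{r,s,a,b},\mathcal V)$, a vector $v\in\mathcal V$ satisfies $e_iv=0$ for all $i=1,\dots,n$ if and only if $v=c\,u_{\vec 0}$ for some $c\in\mathbf C$, where $\vec 0=(0,0,\dots,0)\in M$.
   Context: $U_\varepsilon$ is the non-restricted specialization at $q=\varepsilon$ of the quantum algebra $U_q(\mathfrak{sl}_{n+1})$, with generators $e_i,f_i,t_i^{\pm1}$ ($1\le i\le n$). The representation $\Phi_{r,s,a,b}$. Let $M=(\mathbf Z/l\mathbf Z)^{n(n+1)/2}$, with elements $\mathbf m=(m_{jk})_{1\le j\le k\le n}$, and let $\mathcal V=\bigotimes_{1\le j\le k\le n}\mathbf C^l$ with basis $u_{\mathbf m}$, $\mathbf m\in M$. Let $\epsilon_{jk}\in M$ have $(j,k)$-entry $1$ and all other entries $0$. Define $X_{jk}u_{\mathbf m}=u_{\mathbf m+\epsilon_{jk}}$ and $Z_{jk}u_{\mathbf m}=\varepsilon^{m_{jk}}u_{\mathbf m}$. For $r=(r_i),s=(s_i)\in(\mathbf C^\times)^n$ and $a=(a_{jk})_{1\le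 j\le k\le n}$, $b=(b_{jk})_{1\le j\le k\le n}\in(\mathbf C^\times)^{n(n+1)/2}$ put $x_{jk}=a_{jk}X_{jk}$, $z_{jk}=b_{jk}Z_{jk}$, with the convention that $z_{jk}=1$ and $b_{jk}=1$ when $1\le j\le k\le n$ fails. Write $\{z\}=(z-z^{-1})/(\varepsilon-\varepsilon^{-1})$. The representation $\Phi_{r,s,a,b}:U_\varepsilon\to\mathrm{End}(\mathcal V)$ is $$e_i\mapsto\sum_{k=i}^n x_{i,k}x_{i,k+1}\cdots x_{i,n}\{r_iz_{i,k}z_{i,k-1}z_{i-1,k-1}^{-1}z_{i+1,k}^{-1}\},$$ $$f_i\mapsto\sum_{k=1}^i x_{i+1-k,n+1-k}^{-1}x_{i+2-k,n+2-k}^{-1}\cdots x_{i,n}^{-1}\{s_iz_{i+1-k,n-k}z_{i+1-k,n+1-k}^{-1}z_{i-k,n+1-k}z_{i-k,n-k}^{-1}\},$$ $$t_i\mapsto\frac{r_i}{s_i}z_{i,n}^2z_{i-1,n}^{-1}z_{i+1,n}^{-1}.$$ *)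

theory Defs
  imports Complex_Main "HOL-Algebra.Product_Groups"
begin

definition primitive_root_of_unity :: "nat \<Rightarrow> complex \<Rightarrow> bool" where
  "primitive_root_of_unity l \<epsilon> \<longleftrightarrow>
     0 < l \<and> \<epsilon> ^ l = 1 \<and> (\<forall>k. 0 < k \<and> k < l \<longrightarrow> \<epsilon> ^ k \<noteq> 1)"

definition idx :: "nat \<Rightarrow> (nat \<times> nat) set" where
  "idx n = {(j, k). 1 \<le> j \<and> j \<le> k \<and> k \<le> n}"

type_synonym mindex = "nat \<times> nat \<Rightarrow> int"

text \<open>The group \<open>M = (\<int>/l\<int>)\<^bsup>n(n+1)/2\<^esup>\<close>: for \<open>l > 0\<close> the elements of \<open>integer_mod_group l\<close>
  are the residues \<open>0, \<dots>, l - 1\<close>, and elements of \<open>M\<close> are \<open>undefined\<close> outside \<open>idx n\<close>.\<close>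

definition Mgrp :: "nat \<Rightarrow> nat \<Rightarrow> mindex monoid" where
  "Mgrp n l = product_group (idx n) (\<lambda>_. integer_mod_group l)"

definition eps_unit :: "nat \<Rightarrow> nat \<Rightarrow> nat \<Rightarrow> mindex" where
  "eps_unit n j k = (\<lambda>p\<in>idx n. if p = (j, k) then 1 else 0)"

definition zero_index :: "nat \<Rightarrow> mindex" where
  "zero_index n = (\<lambda>p\<in>idx n. 0)"

text \<open>A vector of \<open>\<V>\<close> is given by its coordinates in the basis \<open>u\<^sub>m\<close>, \<open>m \<in> M\<close>, extended
  by zero off \<open>M\<close>.\<close>

type_synonym vect = "mindex \<Rightarrow> complex"
type_synonym oper = "vect \<Rightarrow> vect"

definition Vsp :: "nat \<Rightarrow> nat \<Rightarrow> vect set" where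
  "Vsp n l = {v. \<forall>m. m \<notin> carrier (Mgrp n l) \<longrightarrow> v m = 0}"

definition ubasis :: "mindex \<Rightarrow> vect" where
  "ubasis m = (\<lambda>p. if p = m then 1 else 0)"

text \<open>The linear operator on \<open>\<V>\<close> sending \<open>u\<^sub>m\<close> to \<open>g m\<close> for \<open>m \<in> M\<close>.\<close>

definition lin_op :: "nat \<Rightarrow> nat \<Rightarrow> (mindex \<Rightarrow> vect) \<Rightarrow> oper" where
  "lin_op n l g = (\<lambda>v p. \<Sum>m\<in>carrier (Mgrp n l). v m * g m p)"

definition op_scale :: "complex \<Rightarrow> oper \<Rightarrow> oper" where
  "op_scale c A = (\<lambda>v p. c * A v p)"

definition op_sum :: "(nat \<Rightarrow> oper) \<Rightarrow> nat set \<Rightarrow> oper" where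
  "op_sum A S = (\<lambda>v p. \<Sum>k\<in>S. A k v p)"

text \<open>The ordered product: \<open>op_prod [A\<^sub>1, \<dots>, A\<^sub>d] = A\<^sub>1 \<circ> \<dots> \<circ> A\<^sub>d\<close>.\<close>

definition op_prod :: "oper list \<Rightarrow> oper" where
  "op_prod As = foldr (\<circ>) As id"

text \<open>The inverse in \<open>End(\<V>)\<close>; only meaningful for operators that are bijective on \<open>\<V>\<close>,
  and only its values on \<open>\<V>\<close> matter.\<close>

definition op_inv :: "nat \<Rightarrow> nat \<Rightarrow> oper \<Rightarrow> oper" where
  "op_inv n l A = inv_into (Vsp n l) A"

definition Xop :: "nat \<Rightarrow> nat \<Rightarrow> nat \<Rightarrow> nat \<Rightarrow> oper" where
  "Xop n l j k = lin_op n l (\<lambda>m. ubasis (m \<otimes>\<^bsub>Mgrp n l\<^esub> eps_unit n j k))"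

definition Zop :: "nat \<Rightarrow> nat \<Rightarrow> complex \<Rightarrow> nat \<Rightarrow> nat \<Rightarrow> oper" where
  "Zop n l \<epsilon> j k = lin_op n l (\<lambda>m p. \<epsilon> powi (m (j, k)) * ubasis m p)"

definition xop :: "nat \<Rightarrow> nat \<Rightarrow> (nat \<Rightarrow> nat \<Rightarrow> complex) \<Rightarrow> nat \<Rightarrow> nat \<Rightarrow> oper" where
  "xop n l a j k = op_scale (a j k) (Xop n l j k)"

definition bconv :: "nat \<Rightarrow> (nat \<Rightarrow> nat \<Rightarrow> complex) \<Rightarrow> nat \<Rightarrow> nat \<Rightarrow> complex" where
  "bconv n b j k = (if (j, k) \<in> idx n then b j k else 1)"

definition zop ::
  "nat \<Rightarrow> nat \<Rightarrow> complex \<Rightarrow> (nat \<Rightarrow> nat \<Rightarrow> complex) \<Rightarrow> nat \<Rightarrow> nat \<Rightarrow> oper" where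
  "zop n l \<epsilon> b j k =
     (if (j, k) \<in> idx n then op_scale (b j k) (Zop n l \<epsilon> j k) else id)"

definition qbrace :: "nat \<Rightarrow> nat \<Rightarrow> complex \<Rightarrow> oper \<Rightarrow> oper" where
  "qbrace n l \<epsilon> A = (\<lambda>v p. (A v p - op_inv n l A v p) / (\<epsilon> - inverse \<epsilon>))"

datatype ugen = E nat | F nat | T nat | Tinv nat

text \<open>The representation of \<open>U\<^sub>\<epsilon>\<close> on \<open>\<V>\<close>, given by the images of the generators
  \<open>e\<^sub>i\<close>, \<open>f\<^sub>i\<close>, \<open>t\<^sub>i\<close>, \<open>t\<^sub>i\<^sup>-\<^sup>1\<close>, \<open>1 \<le> i \<le> n\<close>. For these \<open>i\<close> the truncated
  subtractions below never go negative; indices \<open>(j, k)\<close> outside \<open>idx n\<close> occur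
  in \<open>zop\<close> only.\<close>

fun Phi :: "nat \<Rightarrow> nat \<Rightarrow> complex \<Rightarrow> (nat \<Rightarrow> complex) \<Rightarrow> (nat \<Rightarrow> complex) \<Rightarrow>
    (nat \<Rightarrow> nat \<Rightarrow> complex) \<Rightarrow> (nat \<Rightarrow> nat \<Rightarrow> complex) \<Rightarrow> ugen \<Rightarrow> oper" where
  "Phi n l \<epsilon> r s a b (E i) =
     (let x = xop n l a; z = zop n l \<epsilon> b; iv = op_inv n l in
      op_sum (\<lambda>k. op_prod (map (\<lambda>d. x i d) [k..<n+1]) \<circ>
        qbrace n l \<epsilon> (op_scale (r i)
          (op_prod [z i k, z i (k-1), iv (z (i-1) (k-1)), iv (z (i+1) k)]))) {i..n})"
| "Phi n l \<epsilon> r s a b (F i) =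
     (let x = xop n l a; z = zop n l \<epsilon> b; iv = op_inv n l in
      op_sum (\<lambda>k. op_prod (map (\<lambda>d. iv (x (i+d-k) (n+d-k))) [1..<k+1]) \<circ>
        qbrace n l \<epsilon> (op_scale (s i)
          (op_prod [z (i+1-k) (n-k), iv (z (i+1-k) (n+1-k)),
                    z (i-k) (n+1-k), iv (z (i-k) (n-k))]))) {1..i})"
| "Phi n l \<epsilon> r s a b (T i) =
     (let z = zop n l \<epsilon> b; iv = op_inv n l in
      op_scale (r i / s i) (op_prod [z i n, z i n, iv (z (i-1) n), iv (z (i+1) n)]))"
| "Phi n l \<epsilon> r s a b (Tinv i) =
     (let z = zop n l \<epsilon> b; iv = op_inv n l in
      iv (op_scale (r i / s i) (op_prod [z i n, z i n, iv (z (i-1) n), iv (z (i+1) n)])))"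

end

theory Submission
  imports Defs
begin

text \<open>With the given parameters, \<open>e\<^sub>i\<close> sends \<open>u\<^sub>m\<close> to the sum over \<open>k = i, \<dots>, n\<close> of
  \<open>[m\<^sub>i\<^sub>,\<^sub>k + m\<^sub>i\<^sub>,\<^sub>k\<^sub>-\<^sub>1 - m\<^sub>i\<^sub>-\<^sub>1\<^sub>,\<^sub>k\<^sub>-\<^sub>1 - m\<^sub>i\<^sub>+\<^sub>1\<^sub>,\<^sub>k]\<close> times the basis vector obtained by raising the entries
  \<open>(i,k), \<dots>, (i,n)\<close> by one. Let \<open>v\<close> be killed by all \<open>e\<^sub>i\<close>. Downward induction on \<open>i\<close> shows
  \<open>m\<^sub>i\<^sub>,\<^sub>k = m\<^sub>i\<^sub>-\<^sub>1\<^sub>,\<^sub>k\<^sub>-\<^sub>1\<close> on the support of \<open>v\<close>: if this holds below row \<open>i\<close>, then \<open>m\<^sub>i\<^sub>,\<^sub>d = m\<^sub>i\<^sub>+\<^sub>1\<^sub>,\<^sub>d\<^sub>+\<^sub>1\<close>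
  on the support, so the terms of \<open>e\<^sub>iv\<close> with different \<open>k\<close> cannot cancel (a raised index
  violates this equality exactly for \<open>d \<ge> k\<close>), and the coefficient reduces to
  \<open>[m\<^sub>i\<^sub>,\<^sub>k - m\<^sub>i\<^sub>-\<^sub>1\<^sub>,\<^sub>k\<^sub>-\<^sub>1]\<close>. Since row \<open>0\<close> vanishes, so does \<open>m\<close>.\<close>

section \<open>Roots of unity\<close>

lemma primitive_root_powi_eq_1_iff:
  assumes "primitive_root_of_unity l \<epsilon>"
  shows "\<epsilon> powi x = 1 \<longleftrightarrow> int l dvd x"
proof -
  have l: "0 < l" and e1: "\<epsilon> ^ l = 1" and min: "\<And>k. 0 < k \<Longrightarrow> k < l \<Longrightarrow> \<epsilon> ^ k \<noteq> 1"
    using assms by (auto simp: primitive_root_of_unity_def)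
  have e0: "\<epsilon> \<noteq> 0" using l e1 by (auto simp: power_0_left)
  define k where "k = nat (x mod int l)"
  have k: "int k = x mod int l" "k < l" using l by (auto simp: k_def nat_less_iff)
  have "\<epsilon> powi x = \<epsilon> powi (int l * (x div int l) + int k)" by (simp add: k)
  also have "\<dots> = \<epsilon> ^ k"
    using e0 by (simp add: power_int_add power_int_mult e1)
  finally have "\<epsilon> powi x = 1 \<longleftrightarrow> k = 0" using min[of k] k by auto
  also have "\<dots> \<longleftrightarrow> int l dvd x" using k by (metis dvd_eq_mod_eq_0 of_nat_eq_0_iff)
  finally show ?thesis .
qed

text \<open>The quantum integer \<open>[x]\<close>: the brace evaluated at the scalar
  \<open>\<epsilon> powi x\<close>.\<close>

definition qint :: "complex \<Rightarrow> int \<Rightarrow> complex" where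
  "qint \<epsilon> x = (\<epsilon> powi x - inverse (\<epsilon> powi x)) / (\<epsilon> - inverse \<epsilon>)"

text \<open>The numerator vanishes iff \<open>\<epsilon> powi (2 * x) = 1\<close>; as
  \<open>l\<close> is odd, the 2 drops out of the divisibility.\<close>

lemma qint_eq_0_iff:
  assumes "primitive_root_of_unity l \<epsilon>" "odd l" "l > 1"
  shows "qint \<epsilon> x = 0 \<longleftrightarrow> int l dvd x"
proof -
  have e0: "\<epsilon> \<noteq> 0" using assms by (auto simp: primitive_root_of_unity_def power_0_left)
  have *: "\<epsilon> powi y - inverse (\<epsilon> powi y) = 0 \<longleftrightarrow> int l dvd y" for y
  proof -
    have "\<epsilon> powi y - inverse (\<epsilon> powi y) = 0 \<longleftrightarrow> \<epsilon> powi y * \<epsilon> powi y = 1"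
      using e0 by (simp add: field_simps)
    also have "\<dots> \<longleftrightarrow> \<epsilon> powi (2 * y) = 1"
      using e0 by (simp flip: power_int_add)
    also have "\<dots> \<longleftrightarrow> int l dvd 2 * y" by (rule primitive_root_powi_eq_1_iff[OF assms(1)])
    also have "\<dots> \<longleftrightarrow> int l dvd y"
      using assms(2) by (intro coprime_dvd_mult_right_iff) simp
    finally show ?thesis .
  qed
  \<comment> \<open>The denominator is the numerator at exponent 1, which \<open>l > 1\<close> does
    not divide.\<close>
  have "\<epsilon> - inverse \<epsilon> \<noteq> 0" using *[of 1] assms(3) by simp
  thus ?thesis using * by (simp add: qint_def)
qed

section \<open>Shifts of multi-indices\<close>

lemma carrier_Mgrp:
  assumes "l > 0"
  shows "carrier (Mgrp n l) = idx n \<rightarrow>\<^sub>E {0..<int l}"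
  using assms by (simp add: Mgrp_def carrier_integer_mod_group)

lemma finite_idx: "finite (idx n)"
  by (rule finite_subset[of _ "{..n} \<times> {..n}"]) (auto simp: idx_def)

lemma finite_carrier_Mgrp: "l > 0 \<Longrightarrow> finite (carrier (Mgrp n l))"
  by (simp add: carrier_Mgrp finite_PiE finite_idx)

text \<open>Acting on a set of positions turns a product of operators \<open>xop\<close> along a row
  into a single shift; \<open>t = -1\<close> recovers the source index.\<close>

definition shift :: "nat \<Rightarrow> nat \<Rightarrow> (nat \<times> nat) set \<Rightarrow> int \<Rightarrow> mindex \<Rightarrow> mindex" where
  "shift n l A t m = (\<lambda>q\<in>idx n. if q \<in> A then (m q + t) mod int l else m q)"

lemma shift_carrier:
  assumes "l > 0" "m \<in> carrier (Mgrp n l)"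
  shows "shift n l A t m \<in> carrier (Mgrp n l)"
  using assms by (auto simp: carrier_Mgrp shift_def PiE_iff)

lemma shift_shift_neg:
  assumes "l > 0" "m \<in> carrier (Mgrp n l)" "u = - t"
  shows "shift n l A u (shift n l A t m) = m"
  using assms by (intro ext) (auto simp: carrier_Mgrp shift_def PiE_iff extensional_def mod_simps)

lemma shift_shift_disjoint:
  assumes "A \<inter> B = {}"
  shows "shift n l A t (shift n l B t m) = shift n l (A \<union> B) t m"
  using assms by (intro ext) (auto simp: shift_def)

lemma shift_empty:
  assumes "l > 0" "m \<in> carrier (Mgrp n l)"
  shows "shift n l {} t m = m"
  using assms by (intro ext) (auto simp: carrier_Mgrp shift_def PiE_iff extensional_def)

lemma mult_eps_unit:
  assumes "l > 0" "m \<in> carrier (Mgrp n l)"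
  shows "m \<otimes>\<^bsub>Mgrp n l\<^esub> eps_unit n j k = shift n l {(j, k)} 1 m"
  using assms
  by (intro ext) (auto simp: Mgrp_def shift_def eps_unit_def carrier_integer_mod_group PiE_iff
      mult_integer_mod_group)

section \<open>The operators in coordinates\<close>

lemma Xop_apply:
  assumes "l > 0"
  shows "Xop n l j k v p =
    (if p \<in> carrier (Mgrp n l) then v (shift n l {(j, k)} (-1) p) else 0)"
proof -
  let ?M = "carrier (Mgrp n l)"
  have "Xop n l j k v p = (\<Sum>m\<in>?M. if p = shift n l {(j, k)} 1 m then v m else 0)"
    unfolding Xop_def lin_op_def
    by (intro sum.cong) (auto simp: ubasis_def mult_eps_unit[OF assms])
  \<comment> \<open>The shift permutes M, so the condition can be solved for \<open>m\<close> and
    the sum collapses to one term.\<close>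
  also have "\<dots> = (\<Sum>m\<in>?M. if p \<in> ?M \<and> shift n l {(j, k)} (-1) p = m then v m else 0)"
    using assms
    by (intro sum.cong refl if_cong) (auto simp: shift_shift_neg shift_carrier)
  also have "\<dots> = (if p \<in> ?M then v (shift n l {(j, k)} (-1) p) else 0)"
    using assms by (auto simp: finite_carrier_Mgrp shift_carrier)
  finally show ?thesis .
qed

lemma xop_apply:
  assumes "l > 0"
  shows "xop n l a j k v p =
    (if p \<in> carrier (Mgrp n l) then a j k * v (shift n l {(j, k)} (-1) p) else 0)"
  by (simp add: xop_def op_scale_def Xop_apply[OF assms])

lemma op_prod_xop_apply:
  assumes "l > 0" "w \<in> Vsp n l" "k \<le> Suc n"
  shows "op_prod (map (xop n l a i) [k..<Suc n]) w p =
    (if p \<in> carrier (Mgrp n l)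
     then (\<Prod>d=k..n. a i d) * w (shift n l ({i} \<times> {k..n}) (-1) p) else 0)"
  using assms(3)
proof (induction arbitrary: p rule: inc_induct)
  \<comment> \<open>The product is empty; the value 0 off M comes from
    \<open>w \<in> Vsp n l\<close>.\<close>
  case base
  thus ?case using assms by (simp add: op_prod_def shift_empty Vsp_def)
next
  case (step k)
  let ?W = "op_prod (map (xop n l a i) [Suc k..<Suc n]) w"
  have k: "k \<le> n" using step by simp
  have un: "{i} \<times> {Suc k..n} \<union> {(i, k)} = {i} \<times> {k..n}" using k by auto
  have "op_prod (map (xop n l a i) [k..<Suc n]) w = xop n l a i k ?W"
    using k by (simp add: op_prod_def upt_rec[of k "Suc n"] del: upt_Suc)
  moreover have "shift n l ({i} \<times> {Suc k..n}) (-1) (shift n l {(i, k)} (-1) p)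
      = shift n l ({i} \<times> {k..n}) (-1) p"
    by (subst shift_shift_disjoint) (use un in auto)
  moreover have "xop n l a i k ?W p = (if p \<in> carrier (Mgrp n l) then
      a i k * ((\<Prod>d=Suc k..n. a i d) *
        w (shift n l ({i} \<times> {Suc k..n}) (-1) (shift n l {(i, k)} (-1) p))) else 0)"
    using assms(1) by (simp only: xop_apply step.IH shift_carrier if_True cong: if_cong)
  ultimately show ?case
    using k by (simp only: prod.atLeast_Suc_atMost mult.assoc)
qed

text \<open>Restricted to \<open>Vsp n l\<close> because \<open>op_inv\<close> is meaningful only
  there.\<close>

definition diag_on :: "nat \<Rightarrow> nat \<Rightarrow> oper \<Rightarrow> (mindex \<Rightarrow> complex) \<Rightarrow> bool" where
  "diag_on n l A D \<longleftrightarrow> (\<forall>v\<in>Vsp n l. A v = (\<lambda>m. D m * v m))"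

lemma mult_in_Vsp: "v \<in> Vsp n l \<Longrightarrow> (\<lambda>m. D m * v m) \<in> Vsp n l"
  by (simp add: Vsp_def)

lemma diag_on_id: "diag_on n l id (\<lambda>_. 1)"
  by (simp add: diag_on_def)

lemma diag_on_prod_Nil: "diag_on n l (op_prod []) (\<lambda>_. 1)"
  by (simp add: op_prod_def diag_on_id)

lemma diag_on_prod_Cons:
  "diag_on n l A D \<Longrightarrow> diag_on n l (op_prod As) D' \<Longrightarrow>
    diag_on n l (op_prod (A # As)) (\<lambda>m. D m * D' m)"
  by (simp add: diag_on_def op_prod_def mult_in_Vsp mult.assoc)

lemma diag_on_scale: "diag_on n l A D \<Longrightarrow> diag_on n l (op_scale c A) (\<lambda>m. c * D m)"
  by (simp add: diag_on_def op_scale_def mult.assoc)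

text \<open>A nowhere vanishing diagonal makes \<open>A\<close> injective on \<open>Vsp n l\<close>,
  so \<open>inv_into\<close> must return the coordinatewise quotient.\<close>

lemma diag_on_inv:
  assumes "diag_on n l A D" "\<And>m. D m \<noteq> 0"
  shows "diag_on n l (op_inv n l A) (\<lambda>m. inverse (D m))"
  unfolding diag_on_def
proof
  fix v assume v: "v \<in> Vsp n l"
  let ?w = "\<lambda>m. inverse (D m) * v m"
  have "inj_on A (Vsp n l)"
    using assms by (auto simp: inj_on_def diag_on_def fun_eq_iff)
  moreover have "?w \<in> Vsp n l" by (rule mult_in_Vsp[OF v])
  moreover from this have "A ?w = v"
    using assms by (simp add: diag_on_def flip: mult.assoc)
  ultimately show "op_inv n l A v = ?w"
    using inv_into_f_f[of A "Vsp n l" ?w] by (simp only: op_inv_def)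
qed

lemma Zop_diag:
  assumes "l > 0"
  shows "diag_on n l (Zop n l \<epsilon> j k) (\<lambda>m. \<epsilon> powi m (j, k))"
  unfolding diag_on_def
proof (intro ballI ext)
  fix v p assume v: "v \<in> Vsp n l"
  have "Zop n l \<epsilon> j k v p =
      (\<Sum>m\<in>carrier (Mgrp n l). if p = m then \<epsilon> powi m (j, k) * v m else 0)"
    unfolding Zop_def lin_op_def by (intro sum.cong) (auto simp: ubasis_def)
  also have "\<dots> = \<epsilon> powi p (j, k) * v p"
    using v assms by (auto simp: finite_carrier_Mgrp Vsp_def)
  finally show "Zop n l \<epsilon> j k v p = \<epsilon> powi p (j, k) * v p" .
qed

text \<open>The convention \<open>z\<^sub>j\<^sub>k = 1\<close> outside \<open>idx n\<close> amounts to reading \<open>m\<^sub>j\<^sub>k\<close> as \<open>0\<close> there.\<close>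

definition entry :: "nat \<Rightarrow> mindex \<Rightarrow> nat \<Rightarrow> nat \<Rightarrow> int" where
  "entry n m j k = (if (j, k) \<in> idx n then m (j, k) else 0)"

lemma zop_diag:
  assumes "l > 0"
  shows "diag_on n l (zop n l \<epsilon> b j k) (\<lambda>m. bconv n b j k * \<epsilon> powi entry n m j k)"
  using diag_on_scale[OF Zop_diag[OF assms], of n "b j k" \<epsilon> j k] diag_on_id[of n l]
  by (simp add: zop_def bconv_def entry_def)

text \<open>The exponent of \<open>\<epsilon>\<close> left in the \<open>k\<close>-th brace of
  \<open>E i\<close> once the scalars cancel.\<close>

definition weight :: "nat \<Rightarrow> nat \<Rightarrow> nat \<Rightarrow> mindex \<Rightarrow> int" where
  "weight n i k m =
     entry n m i k + entry n m i (k-1) - entry n m (i-1) (k-1) - entry n m (i+1) k"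

text \<open>The scalars collect into the left side of hypothesis \<open>1\<close>, so the brace is
  applied to a pure power of \<open>\<epsilon>\<close>.\<close>

lemma qbrace_diag:
  assumes "l > 0" "\<epsilon> \<noteq> 0" and b: "\<And>j k. (j, k) \<in> idx n \<Longrightarrow> b j k \<noteq> 0"
    and 1: "r * bconv n b i k * bconv n b i (k - 1) * inverse (bconv n b (i - 1) (k - 1))
             * inverse (bconv n b (i + 1) k) = 1"
    and z: "z = zop n l \<epsilon> b" and iv: "iv = op_inv n l"
  shows "diag_on n l (qbrace n l \<epsilon> (op_scale r
          (op_prod [z i k, z i (k-1), iv (z (i-1) (k-1)), iv (z (i+1) k)])))
          (\<lambda>m. qint \<epsilon> (weight n i k m))"
proof -
  have b0: "bconv n b j k \<noteq> 0" for j k using b by (simp add: bconv_def)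
  define d where "d j k m = bconv n b j k * \<epsilon> powi entry n m j k" for j k m
  have d: "diag_on n l (z j k) (d j k)" for j k
    unfolding z d_def by (rule zop_diag[OF assms(1)])
  have di: "diag_on n l (iv (z j k)) (\<lambda>m. inverse (d j k m))" for j k
    unfolding iv by (rule diag_on_inv[OF d]) (simp add: d_def b0 assms(2))
  define A where "A = op_scale r (op_prod [z i k, z i (k-1), iv (z (i-1) (k-1)), iv (z (i+1) k)])"
  have "diag_on n l A (\<lambda>m. r * (d i k m * (d i (k-1) m * (inverse (d (i-1) (k-1) m) *
      (inverse (d (i+1) k m) * 1)))))"
    unfolding A_def
    by (intro diag_on_scale diag_on_prod_Cons diag_on_prod_Nil d di)
  moreover have "r * (d i k m * (d i (k-1) m * (inverse (d (i-1) (k-1) m) *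
      (inverse (d (i+1) k m) * 1)))) = \<epsilon> powi weight n i k m" for m
  proof -
    have "r * (d i k m * (d i (k-1) m * (inverse (d (i-1) (k-1) m) *
      (inverse (d (i+1) k m) * 1)))) = (r * bconv n b i k * bconv n b i (k - 1) *
        inverse (bconv n b (i - 1) (k - 1)) * inverse (bconv n b (i + 1) k)) * \<epsilon> powi weight n i k m"
      using assms(2) by (simp add: d_def weight_def power_int_add power_int_diff field_simps)
    thus ?thesis by (simp only: 1 mult_1_left)
  qed
  ultimately have A: "diag_on n l A (\<lambda>m. \<epsilon> powi weight n i k m)" by simp
  have "diag_on n l (op_inv n l A) (\<lambda>m. inverse (\<epsilon> powi weight n i k m))"
    by (rule diag_on_inv[OF A]) (simp add: assms(2))
  with A show ?thesis
    unfolding A_def[symmetric]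
    by (simp add: diag_on_def qbrace_def qint_def fun_eq_iff algebra_simps diff_divide_distrib)
qed

text \<open>For each \<open>k\<close>, the coordinate at \<open>p\<close> receives a term from the
  index that raising columns \<open>k..n\<close> of row \<open>i\<close> carries to
  \<open>p\<close>; the brace acts first, hence its weight is taken at that source.\<close>

lemma Phi_E_apply:
  assumes "l > 0" "\<epsilon> \<noteq> 0" "1 \<le> i" and b: "\<And>j k. (j, k) \<in> idx n \<Longrightarrow> b j k \<noteq> 0"
    and a1: "\<And>k. (i, k) \<in> idx n \<Longrightarrow> (\<Prod>d=k..n. a i d) = 1"
    and b1: "\<And>k. (i, k) \<in> idx n \<Longrightarrow>
           r i * bconv n b i k * bconv n b i (k - 1) * inverse (bconv n b (i - 1) (k - 1))
             * inverse (bconv n b (i + 1) k) = 1"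
    and v: "v \<in> Vsp n l"
  shows "Phi n l \<epsilon> r s a b (E i) v p =
    (if p \<in> carrier (Mgrp n l) then
       (\<Sum>k\<in>{i..n}. let m = shift n l ({i} \<times> {k..n}) (-1) p in qint \<epsilon> (weight n i k m) * v m)
     else 0)"
proof -
  define Q where "Q k = qbrace n l \<epsilon> (op_scale (r i)
     (op_prod [zop n l \<epsilon> b i k, zop n l \<epsilon> b i (k-1), op_inv n l (zop n l \<epsilon> b (i-1) (k-1)),
               op_inv n l (zop n l \<epsilon> b (i+1) k)]))" for k
  have Q: "Q k v = (\<lambda>m. qint \<epsilon> (weight n i k m) * v m)" if "k \<in> {i..n}" for k
  proof -
    have "(i, k) \<in> idx n" using that assms(3) by (simp add: idx_def)
    from qbrace_diag[OF assms(1,2) b b1[OF this] refl refl] show ?thesis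
      using v by (simp add: diag_on_def Q_def)
  qed
  have "Phi n l \<epsilon> r s a b (E i) v p =
      (\<Sum>k\<in>{i..n}. op_prod (map (xop n l a i) [k..<Suc n]) (Q k v) p)"
    by (simp add: op_sum_def Q_def Let_def del: upt_Suc)
  also have "\<dots> = (\<Sum>k\<in>{i..n}. if p \<in> carrier (Mgrp n l) then
       let m = shift n l ({i} \<times> {k..n}) (-1) p in qint \<epsilon> (weight n i k m) * v m else 0)"
    using assms(1,3) v
    by (intro sum.cong refl)
       (simp add: Q op_prod_xop_apply mult_in_Vsp a1 idx_def Let_def del: upt_Suc)
  finally show ?thesis by simp
qed

section \<open>The joint kernel\<close>

text \<open>Neither shift touches row \<open>Suc i\<close>, which therefore keeps a copy of the
  unshifted row \<open>i\<close>; comparison with it reveals the column where raising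
  starts.\<close>

lemma shift_row_unique:
  assumes l: "l > 1" and m: "m \<in> carrier (Mgrp n l)" and m': "m' \<in> carrier (Mgrp n l)"
    and i: "1 \<le> i" and k: "k \<in> {i..n}" "k' \<in> {i..n}"
    and eq: "shift n l ({i} \<times> {k..n}) 1 m = shift n l ({i} \<times> {k'..n}) 1 m'"
    and row: "\<And>d. d \<in> {i..<n} \<Longrightarrow> m (i, d) = m (Suc i, Suc d)"
    and row': "\<And>d. d \<in> {i..<n} \<Longrightarrow> m' (i, d) = m' (Suc i, Suc d)"
  shows "k = k'"
proof (rule ccontr)
  assume ne: "k \<noteq> k'"
  \<comment> \<open>Exactly one of the two shifts raises \<open>(i, d)\<close>. Since
    \<open>k \<noteq> k'\<close> forces \<open>d < n\<close>, the reference position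
    \<open>(Suc i, Suc d)\<close> exists.\<close>
  define d where "d = min k k'"
  have d: "d \<in> {i..<n}" using k ne by (auto simp: d_def)
  have idx: "(i, d) \<in> idx n" "(Suc i, Suc d) \<in> idx n" using d i by (auto simp: idx_def)
  have "m (Suc i, Suc d) = m' (Suc i, Suc d)"
    using fun_cong[OF eq, of "(Suc i, Suc d)"] idx by (simp add: shift_def)
  hence same: "m (i, d) = m' (i, d)" using row row' d by simp
  moreover have "(m (i, d) + 1) mod int l \<noteq> m (i, d)"
  proof
    assume *: "(m (i, d) + 1) mod int l = m (i, d)"
    have "0 \<le> m (i, d)" "m (i, d) < int l"
      using m idx l by (auto simp: carrier_Mgrp PiE_iff)
    with * l show False
      by (cases "m (i, d) + 1 = int l") (auto simp: mod_pos_pos_trivial)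
  qed
  ultimately show False
    using fun_cong[OF eq, of "(i, d)"] idx d k ne
    by (auto simp: shift_def d_def min_def split: if_splits)
qed

theorem proposition4p2:
  fixes n l :: nat and \<epsilon> :: complex
    and r s :: "nat \<Rightarrow> complex" and a b :: "nat \<Rightarrow> nat \<Rightarrow> complex" and v :: vect
  assumes "n \<ge> 1" and "l > 1" and "odd l" and "primitive_root_of_unity l \<epsilon>"
    and "\<And>i. i \<in> {1..n} \<Longrightarrow> r i \<noteq> 0 \<and> s i \<noteq> 0"
    and "\<And>j k. (j, k) \<in> idx n \<Longrightarrow> a j k \<noteq> 0 \<and> b j k \<noteq> 0"
    and "\<And>i k. (i, k) \<in> idx n \<Longrightarrow> (\<Prod>d=k..n. a i d) = 1"
    and "\<And>i k. (i, k) \<in> idx n \<Longrightarrow>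
           r i * bconv n b i k * bconv n b i (k - 1) * inverse (bconv n b (i - 1) (k - 1))
             * inverse (bconv n b (i + 1) k) = 1"
    and "v \<in> Vsp n l"
  shows "(\<forall>i\<in>{1..n}. Phi n l \<epsilon> r s a b (E i) v = (\<lambda>_. 0)) \<longleftrightarrow>
         (\<exists>c. v = (\<lambda>m. c * ubasis (zero_index n) m))"
proof -
  let ?M = "carrier (Mgrp n l)"
  have l0: "l > 0" using assms(2) by simp
  have e0: "\<epsilon> \<noteq> 0" using assms(2,4) by (auto simp: primitive_root_of_unity_def power_0_left)
  note qint0 = qint_eq_0_iff[OF assms(4,3,2)]
  have E: "Phi n l \<epsilon> r s a b (E i) v p =
    (if p \<in> ?M then
       (\<Sum>k\<in>{i..n}. let m = shift n l ({i} \<times> {k..n}) (-1) p in qint \<epsilon> (weight n i k m) * v m)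
     else 0)" if "i \<in> {1..n}" for i p
    using that assms(6-9) by (intro Phi_E_apply l0 e0) auto
  show ?thesis
  proof
    assume "\<exists>c. v = (\<lambda>m. c * ubasis (zero_index n) m)"
    then obtain c where c: "v = (\<lambda>m. c * ubasis (zero_index n) m)" ..
    \<comment> \<open>Off the zero index \<open>v\<close> itself vanishes, so every summand of
      \<open>E\<close> is 0.\<close>
    have "weight n i k (zero_index n) = 0" for i k
      by (simp add: weight_def entry_def zero_index_def)
    hence "qint \<epsilon> (weight n i k m) * v m = 0" for i k m
      by (simp add: c ubasis_def qint_def)
    thus "\<forall>i\<in>{1..n}. Phi n l \<epsilon> r s a b (E i) v = (\<lambda>_. 0)"
      by (auto simp: fun_eq_iff E Let_def simp del: Phi.simps mult_eq_0_iff intro!: sum.neutral)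
  next
    assume ker: "\<forall>i\<in>{1..n}. Phi n l \<epsilon> r s a b (E i) v = (\<lambda>_. 0)"
    have supp: "m \<in> ?M" if "v m \<noteq> 0" for m using that assms(9) by (auto simp: Vsp_def)
    have bounds: "0 \<le> entry n m j k" "entry n m j k < int l" if "m \<in> ?M" for m j k
      using that l0 by (auto simp: entry_def carrier_Mgrp PiE_iff)
    have diagonal: "entry n m i k = entry n m (i-1) (k-1)"
      if "i \<le> n" "1 \<le> i" "v m \<noteq> 0" "k \<in> {i..n}" for i m k
      using that
    proof (induction "n - i" arbitrary: i m k rule: less_induct)
      case less
      let ?up = "\<lambda>k. shift n l ({i} \<times> {k..n}) 1" and ?down = "\<lambda>k. shift n l ({i} \<times> {k..n}) (-1)"
      have mM: "m \<in> ?M" by (rule supp[OF less.prems(3)])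
      \<comment> \<open>The row below is needed at every support index, hence the generalized
        induction. For \<open>i = n\<close> the range of \<open>d\<close> is empty, which starts
        it.\<close>
      have row: "m' (i, d) = m' (Suc i, Suc d)" if "v m' \<noteq> 0" "d \<in> {i..<n}" for m' d
        using less.hyps[of "Suc i" m' "Suc d"] that less.prems
        by (simp add: entry_def idx_def diff_less_mono2)
      define p where "p = ?up k m"
      have pM: "p \<in> ?M" unfolding p_def by (rule shift_carrier[OF l0 mM])
      have down: "?down k p = m" unfolding p_def by (rule shift_shift_neg[OF l0 mM]) simp
      \<comment> \<open>A nonzero value would give a second support index raised to \<open>p\<close>
        from another column, against \<open>shift_row_unique\<close>.\<close>
      have other: "v (?down k' p) = 0" if k': "k' \<in> {i..n}" "k' \<noteq> k" for k'
      proof (rule ccontr)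
        assume nz: "v (?down k' p) \<noteq> 0"
        have "?up k' (?down k' p) = p" by (rule shift_shift_neg[OF l0 pM]) simp
        hence "?up k m = ?up k' (?down k' p)" by (simp add: p_def)
        hence "k = k'"
          using shift_row_unique[OF assms(2) mM supp[OF nz] less.prems(2,4) k'(1)]
            row[OF less.prems(3)] row[OF nz] by blast
        with k' show False by simp
      qed
      have "0 = Phi n l \<epsilon> r s a b (E i) v p"
        using ker less.prems by (simp del: Phi.simps)
      also have "\<dots> = (\<Sum>k'\<in>{i..n}. qint \<epsilon> (weight n i k' (?down k' p)) * v (?down k' p))"
        using E[of i p] pM less.prems(1,2) by (simp add: Let_def del: Phi.simps)
      also have "\<dots> = (\<Sum>k'\<in>{i..n}. if k' = k then qint \<epsilon> (weight n i k m) * v m else 0)"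
        by (intro sum.cong) (auto simp: down other)
      also have "\<dots> = qint \<epsilon> (weight n i k m) * v m" using less.prems(4) by simp
      finally have "int l dvd weight n i k m" using less.prems(3) qint0 by simp
      \<comment> \<open>For \<open>k = i\<close> both positions lie outside \<open>idx n\<close> and
        read 0; otherwise this is \<open>row\<close> at column \<open>k - 1\<close>.\<close>
      moreover have "entry n m i (k-1) = entry n m (i+1) k"
      proof (cases "k = i")
        case False
        hence "k - 1 \<in> {i..<n}" "k = Suc (k - 1)" using less.prems(4) by auto
        thus ?thesis using row[OF less.prems(3), of "k - 1"] less.prems
          by (auto simp: entry_def idx_def)
      qed (auto simp: entry_def idx_def)
      ultimately have "int l dvd entry n m i k - entry n m (i-1) (k-1)"
        by (simp add: weight_def)
      hence "entry n m i k mod int l = entry n m (i-1) (k-1) mod int l"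
        by (simp add: mod_eq_dvd_iff)
      \<comment> \<open>Both entries lie in \<open>{0..<int l}\<close>, so congruence is
        equality.\<close>
      thus ?case using bounds[OF mM] by (simp add: mod_pos_pos_trivial)
    qed
    \<comment> \<open>Each diagonal is followed up to row 0, where \<open>entry\<close> is 0 by
      convention.\<close>
    have zero: "entry n m i k = 0" if "v m \<noteq> 0" "i \<le> n" for m i k
      using that(2)
    proof (induction i arbitrary: k)
      case 0
      thus ?case by (simp add: entry_def idx_def)
    next
      case (Suc i)
      show ?case
      proof (cases "k \<in> {Suc i..n}")
        case True
        thus ?thesis using diagonal[of "Suc i"] Suc that(1) by simp
      qed (auto simp: entry_def idx_def)
    qed
    have only_zero: "m = zero_index n" if "v m \<noteq> 0" for m
    proof
      fix q
      show "m q = zero_index n q"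
        using zero[OF that, of "fst q" "snd q"] supp[OF that] l0
        by (cases q) (auto simp: entry_def zero_index_def carrier_Mgrp PiE_iff extensional_def idx_def
            split: if_splits)
    qed
    have "v = (\<lambda>m. v (zero_index n) * ubasis (zero_index n) m)"
      using only_zero by (intro ext) (auto simp: ubasis_def)
    thus "\<exists>c. v = (\<lambda>m. c * ubasis (zero_index n) m)" ..
  qed
qed

end
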